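(* Let $C\in\mathbb{R}^{N\times N}$ be symmetric positive semi-definite and $G\in\mathbb{R}^{N\times N}$ positive definite (not necessarily symmetric). Let $H=G^{-1}$ and $B=G^{-1}C$. Suppose that $(H+H^\top)/2$ is positive definite with eigenvalues in $[\xi_1,\xi_2]$, $\xi_1>0$; that $(H-H^\top)/2$ has eigenvalues in $[-i\xi_3,i\xi_3]$; and that the eigenvalues of $C$ lie in $\{0\}\cup[\xi_4,\xi_5]$, $\xi_4>0$. Then $\mathcal F_C(B)\subset\mathcal D(c_1,\rho_1)$ for some real $c_1>\rho_1>0$, where $c_1,\rho_1$ can be chosen depending only on the parameters $\xi_1,\xi_2,\xi_3,\xi_4,\xi_5$.
   Context: A real square matrix $G$ is positive definite if $v^\top Gv>0$ for every nonzero real $v$. $\mathcal D(c,\rho)\subset\mathbb{C}$ denotes the (closed) disk with center $c$ and radius $\rho$. The $C$-numerical range of a matrix $A=KC$ is $\mathcal F_C(A)=\{x^*CAx:x\in\mathbb{C}^N,\ \|x\|_C=1\}$, where $\|x\|_C=\sqrt{x^*Cx}$; thus $\mathcal F_C(B)=\{x^*CG^{-1}Cx/(x^*Cx):x\in\mathbb{C}^N,\ Cx\ne0\}$. *)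

theory Defs
  imports
    "HOL-Analysis.Elementary_Metric_Spaces"
    "Jordan_Normal_Form.Spectral_Radius"
begin

text \<open>
  Matrices with explicit carriers are used (rather than type-indexed ones) so that the size
  can be quantified inside a formula, after the constants that must not depend on it.
\<close>

abbreviation cmat :: "real mat \<Rightarrow> complex mat" where
  "cmat \<equiv> map_mat complex_of_real"

definition pos_def_mat :: "nat \<Rightarrow> real mat \<Rightarrow> bool" where
  "pos_def_mat n A \<longleftrightarrow> A \<in> carrier_mat n n \<and>
     (\<forall>v \<in> carrier_vec n. v \<noteq> 0\<^sub>v n \<longrightarrow> scalar_prod v (A *\<^sub>v v) > 0)"

definition sym_pos_semidef_mat :: "nat \<Rightarrow> real mat \<Rightarrow> bool" where
  "sym_pos_semidef_mat n A \<longleftrightarrow> A \<in> carrier_mat n n \<and> transpose_mat A = A \<and>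
     (\<forall>v \<in> carrier_vec n. scalar_prod v (A *\<^sub>v v) \<ge> 0)"

definition sym_part :: "real mat \<Rightarrow> real mat" where
  "sym_part H = (1 / 2) \<cdot>\<^sub>m (H + transpose_mat H)"

definition skew_part :: "real mat \<Rightarrow> real mat" where
  "skew_part H = (1 / 2) \<cdot>\<^sub>m (H - transpose_mat H)"

text \<open>
  \<open>qform M x\<close> is \<open>x\<^sup>* M x\<close>: the second argument of \<open>scalar_prod\<close> is conjugated,
  and \<open>scalar_prod\<close> is commutative.
\<close>
definition qform :: "complex mat \<Rightarrow> complex vec \<Rightarrow> complex" where
  "qform M x = scalar_prod (M *\<^sub>v x) (conjugate x)"

text \<open>
  The C-seminorm; for Hermitian positive semi-definite \<open>C\<close> the number \<open>x\<^sup>* C x\<close> is real and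
  nonnegative, so taking its real part discards nothing.
\<close>
definition C_norm :: "complex mat \<Rightarrow> complex vec \<Rightarrow> real" where
  "C_norm C x = sqrt (Re (qform C x))"

definition C_numerical_range :: "complex mat \<Rightarrow> complex mat \<Rightarrow> complex set" where
  "C_numerical_range C A = {qform (C * A) x | x. x \<in> carrier_vec (dim_row C) \<and> C_norm C x = 1}"

lemma pos_def_mat_inverse_exists:
  assumes "pos_def_mat n G"
  shows "\<exists>H \<in> carrier_mat n n. inverts_mat G H \<and> inverts_mat H G"
proof -
  have G: "G \<in> carrier_mat n n" using assms by (simp add: pos_def_mat_def)
  have "det G \<noteq> 0"
  proof
    assume "det G = 0"
    then obtain v where v: "v \<in> carrier_vec n" "v \<noteq> 0\<^sub>v n" "G *\<^sub>v v = 0\<^sub>v n"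
      using det_0_iff_vec_prod_zero[OF G] by blast
    then have "scalar_prod v (G *\<^sub>v v) = 0" by simp
    then show False using assms v(1,2) by (force simp: pos_def_mat_def)
  qed
  then have "G \<in> Units (ring_mat TYPE(real) n ())"
    by (rule det_non_zero_imp_unit[OF G])
  then obtain H where "H \<in> carrier_mat n n" "G * H = 1\<^sub>m n" "H * G = 1\<^sub>m n"
    by (auto simp: Units_def ring_mat_def)
  then show ?thesis using G by (auto simp: inverts_mat_def)
qed

end

theory Submission
  imports Defs "HOL-Analysis.L2_Norm"
begin

text \<open>
  If \<open>x\<^sup>* C x = 1\<close> and \<open>y = C x\<close>, then the point of the C-numerical range of \<open>B = H C\<close> given by
  \<open>x\<close> is \<open>x\<^sup>* C H C x = y\<^sup>* H y\<close>. Its real part is \<open>y\<^sup>* S y\<close> for the symmetric part \<open>S\<close> of \<open>H\<close> and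
  its imaginary part comes from the skew part, so the spectral bounds give
  \<open>\<xi>1 |y|\<^sup>2 \<le> Re \<le> \<xi>2 |y|\<^sup>2\<close> and \<open>|Im| \<le> \<xi>3 |y|\<^sup>2\<close> (\<open>qform_cmat_rectangle\<close>). Moreover
  \<open>|y|\<^sup>2 = x\<^sup>* C\<^sup>2 x\<close> lies in \<open>[\<xi>4, \<xi>5]\<close>, because \<open>\<lambda>\<^sup>2 - \<xi>4 \<lambda> \<ge> 0 \<ge> \<lambda>\<^sup>2 - \<xi>5 \<lambda>\<close> for every eigenvalue
  \<open>\<lambda>\<close> of \<open>C\<close>, the gap between \<open>0\<close> and \<open>\<xi>4\<close> being what makes the first inequality true
  (\<open>norm_mult_spectral_gap\<close>). Hence the numerical range lies in a rectangle that depends only on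
  the five parameters and stays at distance at least \<open>\<xi>1 \<xi>4\<close> to the right of the imaginary axis, and
  a disk with a far enough center on the positive real axis covers such a rectangle without
  reaching \<open>0\<close> (\<open>bounded_half_plane_in_cball\<close>).

  The passage from eigenvalues to quadratic forms amounts to one fact: the infimum of the Rayleigh
  quotient of a Hermitian matrix is an eigenvalue (\<open>hermitian_qform_ge\<close>). It is proved
  variationally, without diagonalization. If \<open>s\<close> is the infimum then \<open>M = A - s\<close> is positive
  semi-definite, which forces \<open>|M x|\<^sup>2 \<le> K x\<^sup>* M x\<close>; were \<open>M\<close> invertible, then \<open>|x|\<^sup>2 \<le> L |M x|\<^sup>2\<close>, and
  the two inequalities would push the Rayleigh quotient up to at least \<open>s + 1 / (L K)\<close>.
\<close>

section \<open>The Hermitian inner product and bounded matrices\<close>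

text \<open>
  The condition is \<open>A\<^sup>* = A\<close>, phrased as self-adjointness for the inner product because \<open>A\<close> is only
  ever moved from one argument to the other.
\<close>
definition hermitian_mat :: "nat \<Rightarrow> complex mat \<Rightarrow> bool" where
  "hermitian_mat n A \<longleftrightarrow> A \<in> carrier_mat n n \<and>
     (\<forall>u \<in> carrier_vec n. \<forall>v \<in> carrier_vec n. (A *\<^sub>v u) \<bullet>c v = u \<bullet>c (A *\<^sub>v v))"

lemma hermitian_matD:
  assumes "hermitian_mat n A"
  shows "A \<in> carrier_mat n n"
    and "u \<in> carrier_vec n \<Longrightarrow> v \<in> carrier_vec n \<Longrightarrow> (A *\<^sub>v u) \<bullet>c v = u \<bullet>c (A *\<^sub>v v)"
  using assms by (auto simp: hermitian_mat_def)

lemma smult_mat_mult_vec: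
  fixes A :: "'a :: comm_semiring_0 mat"
  assumes "A \<in> carrier_mat n m" "v \<in> carrier_vec m"
  shows "(k \<cdot>\<^sub>m A) *\<^sub>v v = k \<cdot>\<^sub>v (A *\<^sub>v v)"
  using assms by (intro eq_vecI) (auto simp: scalar_prod_def sum_distrib_left mult.assoc)

lemma cscalar_prod_commute:
  fixes u v :: "complex vec"
  assumes "u \<in> carrier_vec n" "v \<in> carrier_vec n"
  shows "v \<bullet>c u = cnj (u \<bullet>c v)"
proof -
  have "u \<bullet>c v = conjugate (conjugate u \<bullet> v)"
    using conjugate_conjugate_sprod[OF assms] by simp
  moreover have "v \<bullet>c u = conjugate u \<bullet> v"
    using conjugate_vec_sprod_comm[of v n u] assms by simp
  ultimately show ?thesis by simp
qed

lemma cscalar_prod_simps: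
  fixes u v w :: "complex vec"
  assumes "u \<in> carrier_vec n" "v \<in> carrier_vec n" "w \<in> carrier_vec n"
  shows "(u + v) \<bullet>c w = u \<bullet>c w + v \<bullet>c w" "w \<bullet>c (u + v) = w \<bullet>c u + w \<bullet>c v"
    "(k \<cdot>\<^sub>v u) \<bullet>c v = k * (u \<bullet>c v)" "u \<bullet>c (k \<cdot>\<^sub>v v) = cnj k * (u \<bullet>c v)"
  using assms
  by (auto simp: add_scalar_prod_distrib[of _ n] conjugate_add_vec[of _ n] conjugate_smult_vec
      scalar_prod_add_distrib[of _ n])

lemma cscalar_prod_self:
  fixes x :: "complex vec"
  assumes "x \<in> carrier_vec n"
  shows "x \<bullet>c x = complex_of_real (\<Sum>i<n. (cmod (x $ i))\<^sup>2)"
  using assms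
  by (auto simp: scalar_prod_def complex_norm_square atLeast0LessThan simp del: of_real_power)

lemma cscalar_prod_self_Re:
  fixes x :: "complex vec"
  assumes "x \<in> carrier_vec n"
  shows "Re (x \<bullet>c x) = (\<Sum>i<n. (cmod (x $ i))\<^sup>2)" "Re (x \<bullet>c x) \<ge> 0"
  using cscalar_prod_self[OF assms] by (auto intro: sum_nonneg)

text \<open>
  Expanding \<open>0 \<le> |u + v|\<^sup>2\<close> gives this weak form of the Cauchy-Schwarz inequality, which is enough
  to bound a quadratic form.
\<close>
lemma two_Re_cscalar_prod_le:
  fixes u v :: "complex vec"
  assumes u: "u \<in> carrier_vec n" and v: "v \<in> carrier_vec n"
  shows "- 2 * Re (u \<bullet>c v) \<le> Re (u \<bullet>c u) + Re (v \<bullet>c v)"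
proof -
  have "0 \<le> Re ((u + v) \<bullet>c (u + v))"
    by (rule cscalar_prod_self_Re[of _ n]) (use u v in auto)
  also have "(u + v) \<bullet>c (u + v) = u \<bullet>c u + u \<bullet>c v + (cnj (u \<bullet>c v) + v \<bullet>c v)"
    using u v cscalar_prod_commute[OF u v] by (simp add: cscalar_prod_simps[where n=n])
  finally show ?thesis by simp
qed

text \<open>
  The squared Frobenius norm serves as \<open>K\<close>, by the Cauchy-Schwarz inequality in each row; adding
  \<open>1\<close> keeps \<open>K\<close> positive for the zero matrix and for \<open>n = 0\<close>.
\<close>
lemma mult_mat_vec_bounded:
  fixes M :: "complex mat"
  assumes M: "M \<in> carrier_mat n n"
  obtains K where "K > 0"
    "\<And>x. x \<in> carrier_vec n \<Longrightarrow> Re ((M *\<^sub>v x) \<bullet>c (M *\<^sub>v x)) \<le> K * Re (x \<bullet>c x)"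
proof -
  define K where "K = (\<Sum>i<n. \<Sum>j<n. (cmod (M $$ (i,j)))\<^sup>2) + 1"
  have "K > 0" unfolding K_def
    by (intro add_nonneg_pos sum_nonneg) auto
  moreover have "Re ((M *\<^sub>v x) \<bullet>c (M *\<^sub>v x)) \<le> K * Re (x \<bullet>c x)" if x: "x \<in> carrier_vec n" for x
  proof -
    have row: "(cmod ((M *\<^sub>v x) $ i))\<^sup>2 \<le> (\<Sum>j<n. (cmod (M $$ (i,j)))\<^sup>2) * Re (x \<bullet>c x)"
      if i: "i < n" for i
    proof -
      have "(M *\<^sub>v x) $ i = (\<Sum>j<n. M $$ (i,j) * x $ j)"
        using M x i by (auto simp: scalar_prod_def atLeast0LessThan)
      also have "cmod \<dots> \<le> (\<Sum>j<n. cmod (M $$ (i,j)) * cmod (x $ j))"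
        by (rule order_trans[OF norm_sum]) (simp add: norm_mult)
      finally have "(cmod ((M *\<^sub>v x) $ i))\<^sup>2 \<le> (\<Sum>j<n. cmod (M $$ (i,j)) * cmod (x $ j))\<^sup>2"
        by (intro power_mono) auto
      also have "\<dots> \<le> (\<Sum>j<n. (cmod (M $$ (i,j)))\<^sup>2) * (\<Sum>j<n. (cmod (x $ j))\<^sup>2)"
      proof -
        have "(\<Sum>j<n. cmod (M $$ (i,j)) * cmod (x $ j))
            \<le> L2_set (\<lambda>j. cmod (M $$ (i,j))) {..<n} * L2_set (\<lambda>j. cmod (x $ j)) {..<n}"
          using L2_set_mult_ineq[of "\<lambda>j. cmod (M $$ (i,j))" "\<lambda>j. cmod (x $ j)" "{..<n}"] by simp
        then have "(\<Sum>j<n. cmod (M $$ (i,j)) * cmod (x $ j))\<^sup>2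
            \<le> (L2_set (\<lambda>j. cmod (M $$ (i,j))) {..<n} * L2_set (\<lambda>j. cmod (x $ j)) {..<n})\<^sup>2"
          by (intro power_mono sum_nonneg) auto
        then show ?thesis
          by (simp add: L2_set_def power_mult_distrib sum_nonneg)
      qed
      finally show ?thesis by (simp only: cscalar_prod_self_Re[OF x])
    qed
    have "Re ((M *\<^sub>v x) \<bullet>c (M *\<^sub>v x)) = (\<Sum>i<n. (cmod ((M *\<^sub>v x) $ i))\<^sup>2)"
      by (rule cscalar_prod_self_Re) (use M x in auto)
    also have "\<dots> \<le> (\<Sum>i<n. (\<Sum>j<n. (cmod (M $$ (i,j)))\<^sup>2) * Re (x \<bullet>c x))"
      using row by (intro sum_mono) auto
    also have "\<dots> \<le> K * Re (x \<bullet>c x)"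
      using cscalar_prod_self_Re(2)[OF x] by (simp add: K_def distrib_right sum_distrib_right)
    finally show ?thesis .
  qed
  ultimately show thesis by (rule that)
qed

lemma qform_bounded_below:
  assumes M: "M \<in> carrier_mat n n"
  obtains K where "\<And>x. x \<in> carrier_vec n \<Longrightarrow> - K * Re (x \<bullet>c x) \<le> Re (qform M x)"
proof -
  obtain K where K: "\<And>x. x \<in> carrier_vec n \<Longrightarrow>
      Re ((M *\<^sub>v x) \<bullet>c (M *\<^sub>v x)) \<le> K * Re (x \<bullet>c x)"
    using mult_mat_vec_bounded[OF M] by metis
  have "- ((K + 1) / 2) * Re (x \<bullet>c x) \<le> Re (qform M x)" if x: "x \<in> carrier_vec n" for x
  proof -
    have "- 2 * Re (qform M x) \<le> Re ((M *\<^sub>v x) \<bullet>c (M *\<^sub>v x)) + Re (x \<bullet>c x)"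
      unfolding qform_def by (rule two_Re_cscalar_prod_le) (use M x in auto)
    with K[OF x] show ?thesis by (simp add: field_simps)
  qed
  then show thesis by (rule that)
qed

lemma qform_simps:
  assumes "A \<in> carrier_mat n n" "x \<in> carrier_vec n"
  shows "B \<in> carrier_mat n n \<Longrightarrow> qform (A + B) x = qform A x + qform B x"
    "qform (k \<cdot>\<^sub>m A) x = k * qform A x" "qform (1\<^sub>m n) x = x \<bullet>c x"
  using assms by (auto simp: qform_def add_mult_distrib_mat_vec[of _ n n] smult_mat_mult_vec[of _ n n]
     cscalar_prod_simps[where n=n])

section \<open>The infimum of the Rayleigh quotient is an eigenvalue\<close>

text \<open>
  A gradient step from \<open>x\<close> cannot make the form negative: with \<open>y = M x\<close> and
  \<open>y\<^sup>* M y \<le> K |y|\<^sup>2\<close>, the inequality \<open>0 \<le> q (x - y / K) \<le> q x - |y|\<^sup>2 / K\<close> for the form \<open>q\<close> of \<open>M\<close>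
  is the claim. In particular the kernel of the form is the kernel of \<open>M\<close>, with a quantitative bound.
\<close>
lemma psd_norm_le_qform:
  assumes M: "hermitian_mat n M"
    and psd: "\<And>x. x \<in> carrier_vec n \<Longrightarrow> 0 \<le> Re (qform M x)"
  obtains K where "K > 0"
    "\<And>x. x \<in> carrier_vec n \<Longrightarrow> Re ((M *\<^sub>v x) \<bullet>c (M *\<^sub>v x)) \<le> K * Re (qform M x)"
proof -
  note Mc = hermitian_matD(1)[OF M]
  have "- 1 \<cdot>\<^sub>m M \<in> carrier_mat n n" using Mc by simp
  then obtain K0 where K0: "\<And>x. x \<in> carrier_vec n \<Longrightarrow> - K0 * Re (x \<bullet>c x) \<le> Re (qform (- 1 \<cdot>\<^sub>m M) x)"
    using qform_bounded_below by metis
  define K where "K = max K0 1"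
  have "K > 0" by (simp add: K_def)
  have K: "Re (qform M x) \<le> K * Re (x \<bullet>c x)" if x: "x \<in> carrier_vec n" for x
  proof -
    have "Re (qform M x) \<le> K0 * Re (x \<bullet>c x)"
      using K0[OF x] by (simp add: qform_simps[OF Mc x])
    also have "\<dots> \<le> K * Re (x \<bullet>c x)"
      using cscalar_prod_self_Re(2)[OF x] by (intro mult_right_mono) (auto simp: K_def)
    finally show ?thesis .
  qed
  have "Re ((M *\<^sub>v x) \<bullet>c (M *\<^sub>v x)) \<le> K * Re (qform M x)" if x: "x \<in> carrier_vec n" for x
  proof -
    define y where "y = M *\<^sub>v x"
    \<comment> \<open>the step length that minimizes the upper bound \<open>q x + 2 t |y|\<^sup>2 + t\<^sup>2 K |y|\<^sup>2\<close>\<close>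
    define t where "t = complex_of_real (- 1 / K)"
    have y: "y \<in> carrier_vec n" using Mc x by (simp add: y_def)
    have ty: "t \<cdot>\<^sub>v y \<in> carrier_vec n" and My: "M *\<^sub>v y \<in> carrier_vec n" using y Mc by auto
    have "M *\<^sub>v (x + t \<cdot>\<^sub>v y) = y + t \<cdot>\<^sub>v (M *\<^sub>v y)"
      using Mc x y by (simp add: mult_add_distrib_mat_vec[of _ n n] mult_mat_vec[of _ n n] y_def)
    then have "qform M (x + t \<cdot>\<^sub>v y) = qform M x + t * (y \<bullet>c y) + t * (y \<bullet>c y) + t * t * qform M y"
      using x y ty My hermitian_matD(2)[OF M y x]
      by (simp add: qform_def cscalar_prod_simps[where n=n] y_def[symmetric] t_def algebra_simps)
    then have "Re (qform M (x + t \<cdot>\<^sub>v y))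
        = Re (qform M x) - 2 / K * Re (y \<bullet>c y) + Re (qform M y) / (K * K)"
      by (simp add: t_def power2_eq_square)
    moreover have "0 \<le> Re (qform M (x + t \<cdot>\<^sub>v y))"
      using x ty by (intro psd) auto
    moreover have "Re (qform M y) / (K * K) \<le> Re (y \<bullet>c y) / K"
      using K[OF y] \<open>K > 0\<close> by (simp add: field_simps)
    ultimately have "Re (y \<bullet>c y) / K \<le> Re (qform M x)" by simp
    then show ?thesis using \<open>K > 0\<close> by (simp add: y_def field_simps)
  qed
  with \<open>K > 0\<close> show thesis by (rule that)
qed

text \<open>
  The shifted matrix is invertible, and \<open>L\<close> is a bound for its inverse.
\<close>
lemma not_eigenvalue_bounded_below:
  fixes A :: "complex mat"
  assumes A: "A \<in> carrier_mat n n" and k: "k \<notin> spectrum A"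
  obtains L where "L > 0"
    "\<And>x. x \<in> carrier_vec n \<Longrightarrow>
       Re (x \<bullet>c x) \<le> L * Re (((A + (- k) \<cdot>\<^sub>m 1\<^sub>m n) *\<^sub>v x) \<bullet>c ((A + (- k) \<cdot>\<^sub>m 1\<^sub>m n) *\<^sub>v x))"
proof -
  define M where "M = A + (- k) \<cdot>\<^sub>m 1\<^sub>m n"
  have M: "M \<in> carrier_mat n n" using A by (simp add: M_def)
  have "char_matrix A k = M"
    using A by (auto simp: char_matrix_def M_def)
  with k have "det M \<noteq> 0"
    using eigenvalue_det[OF A] by (simp add: spectrum_def)
  then have "M \<in> Units (ring_mat TYPE(complex) n ())"
    by (rule det_non_zero_imp_unit[OF M])
  then obtain R where R: "R \<in> carrier_mat n n" "R * M = 1\<^sub>m n"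
    by (auto simp: Units_def ring_mat_def)
  obtain L where L: "L > 0" "\<And>x. x \<in> carrier_vec n \<Longrightarrow>
      Re ((R *\<^sub>v x) \<bullet>c (R *\<^sub>v x)) \<le> L * Re (x \<bullet>c x)"
    using mult_mat_vec_bounded[OF R(1)] by metis
  have "Re (x \<bullet>c x) \<le> L * Re ((M *\<^sub>v x) \<bullet>c (M *\<^sub>v x))" if x: "x \<in> carrier_vec n" for x
  proof -
    have "R *\<^sub>v (M *\<^sub>v x) = x"
      using R M x by (metis assoc_mult_mat_vec one_mult_mat_vec)
    with L(2)[of "M *\<^sub>v x"] M x show ?thesis by simp
  qed
  with L(1) show thesis using that unfolding M_def by blast
qed

lemma hermitian_mat_add:
  assumes "hermitian_mat n A" "hermitian_mat n B"
  shows "hermitian_mat n (A + B)"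
  using assms unfolding hermitian_mat_def
  by (auto simp: add_mult_distrib_mat_vec[of _ n n] cscalar_prod_simps[where n=n])

lemma hermitian_mat_smult:
  assumes "hermitian_mat n A" "cnj k = k"
  shows "hermitian_mat n (k \<cdot>\<^sub>m A)"
  using assms unfolding hermitian_mat_def
  by (auto simp: smult_mat_mult_vec[of _ n n] cscalar_prod_simps[where n=n])

lemma hermitian_mat_one: "hermitian_mat n (1\<^sub>m n)"
  by (auto simp: hermitian_mat_def)

text \<open>
  The supremum \<open>s\<close> of all lower bounds of the Rayleigh quotient is itself a lower bound. If it were
  smaller than \<open>m\<close>, it would not be an eigenvalue, so \<open>A - s\<close> would be positive semi-definite and
  invertible; its form would then dominate a positive multiple of \<open>|y|\<^sup>2\<close>, and \<open>s\<close> could be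
  increased.
\<close>
lemma hermitian_qform_ge:
  assumes A: "hermitian_mat n A"
    and ev: "\<And>t. complex_of_real t \<in> spectrum A \<Longrightarrow> m \<le> t"
    and x: "x \<in> carrier_vec n"
  shows "m * Re (x \<bullet>c x) \<le> Re (qform A x)"
proof (rule ccontr)
  assume neg: "\<not> ?thesis"
  note Ac = hermitian_matD(1)[OF A]
  define S where "S = {r. \<forall>y \<in> carrier_vec n. r * Re (y \<bullet>c y) \<le> Re (qform A y)}"
  have "Re (x \<bullet>c x) \<noteq> 0"
  proof
    assume "Re (x \<bullet>c x) = 0"
    moreover have "x \<bullet>c x = complex_of_real (Re (x \<bullet>c x))"
      using cscalar_prod_self[OF x] by simp
    ultimately have "x = 0\<^sub>v n"
      using conjugate_square_eq_0_vec[OF x] by simp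
    then show False using neg Ac by (simp add: qform_def)
  qed
  with cscalar_prod_self_Re(2)[OF x] have xpos: "Re (x \<bullet>c x) > 0" by linarith
  obtain K0 where "\<And>y. y \<in> carrier_vec n \<Longrightarrow> - K0 * Re (y \<bullet>c y) \<le> Re (qform A y)"
    using qform_bounded_below[OF Ac] by metis
  then have "- K0 \<in> S" by (simp add: S_def)
  then have ne: "S \<noteq> {}" by blast
  have up: "r < m" if "r \<in> S" for r
  proof -
    have "r * Re (x \<bullet>c x) < m * Re (x \<bullet>c x)"
      using that x neg by (force simp: S_def)
    then show ?thesis using xpos by simp
  qed
  then have bdd: "bdd_above S" by (meson bdd_above.I less_imp_le)
  define s where "s = Sup S"
  have sS: "s \<in> S"
  proof -
    have "s * Re (y \<bullet>c y) \<le> Re (qform A y)" if y: "y \<in> carrier_vec n" for y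
    proof (cases "Re (y \<bullet>c y) = 0")
      case True
      then show ?thesis using ne y by (auto simp: S_def)
    next
      case False
      with cscalar_prod_self_Re(2)[OF y] have pos: "Re (y \<bullet>c y) > 0" by linarith
      have "s \<le> Re (qform A y) / Re (y \<bullet>c y)"
        unfolding s_def using ne y pos by (intro cSup_least) (auto simp: S_def field_simps)
      then show ?thesis using pos by (simp add: field_simps)
    qed
    then show ?thesis by (simp add: S_def)
  qed
  define M where "M = A + (- complex_of_real s) \<cdot>\<^sub>m 1\<^sub>m n"
  have M: "hermitian_mat n M"
    unfolding M_def
    by (intro hermitian_mat_add A hermitian_mat_smult hermitian_mat_one) simp
  have qM: "Re (qform M y) = Re (qform A y) - s * Re (y \<bullet>c y)" if "y \<in> carrier_vec n" for y
    using that Ac by (simp add: M_def qform_simps[where n=n])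
  have "0 \<le> Re (qform M y)" if "y \<in> carrier_vec n" for y
    using sS that by (simp add: qM S_def)
  then obtain K where K: "K > 0" "\<And>y. y \<in> carrier_vec n \<Longrightarrow>
      Re ((M *\<^sub>v y) \<bullet>c (M *\<^sub>v y)) \<le> K * Re (qform M y)"
    using psd_norm_le_qform[OF M] by metis
  have "complex_of_real s \<notin> spectrum A"
    using ev[of s] up[OF sS] by auto
  then obtain L where L: "L > 0" "\<And>y. y \<in> carrier_vec n \<Longrightarrow>
      Re (y \<bullet>c y) \<le> L * Re ((M *\<^sub>v y) \<bullet>c (M *\<^sub>v y))"
    using not_eigenvalue_bounded_below[OF Ac] unfolding M_def by metis
  have "s + 1 / (L * K) \<in> S"
  proof -
    have "(s + 1 / (L * K)) * Re (y \<bullet>c y) \<le> Re (qform A y)" if y: "y \<in> carrier_vec n" for y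
    proof -
      have "Re (y \<bullet>c y) \<le> L * (K * Re (qform M y))"
        using L(2)[OF y] K(2)[OF y] L(1) by (meson mult_left_mono less_imp_le order_trans)
      then have "Re (y \<bullet>c y) / (L * K) \<le> Re (qform M y)"
        using L(1) K(1) by (simp add: field_simps)
      then show ?thesis using qM[OF y] by (simp add: algebra_simps)
    qed
    then show ?thesis by (simp add: S_def)
  qed
  then have "s + 1 / (L * K) \<le> s" unfolding s_def by (rule cSup_upper) (rule bdd)
  then show False using L(1) K(1) by (simp add: field_simps)
qed

lemma spectrum_smult_matD:
  fixes A :: "complex mat"
  assumes A: "A \<in> carrier_mat n n" and k: "k \<noteq> 0" and t: "t \<in> spectrum (k \<cdot>\<^sub>m A)"
  shows "t / k \<in> spectrum A"
proof -
  obtain v where v: "v \<in> carrier_vec n" "v \<noteq> 0\<^sub>v n" "(k \<cdot>\<^sub>m A) *\<^sub>v v = t \<cdot>\<^sub>v v"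
    using t A by (auto simp: spectrum_def eigenvalue_def eigenvector_def)
  have "A *\<^sub>v v = (1 / k) \<cdot>\<^sub>v ((k \<cdot>\<^sub>m A) *\<^sub>v v)"
    using A v(1) k by (simp add: smult_mat_mult_vec[of _ n n] smult_smult_assoc)
  also have "\<dots> = (t / k) \<cdot>\<^sub>v v"
    using v by (simp add: smult_smult_assoc)
  finally show ?thesis
    using A v by (auto simp: spectrum_def eigenvalue_def eigenvector_def)
qed

lemma hermitian_qform_le:
  assumes A: "hermitian_mat n A"
    and ev: "\<And>t. complex_of_real t \<in> spectrum A \<Longrightarrow> t \<le> m"
    and x: "x \<in> carrier_vec n"
  shows "Re (qform A x) \<le> m * Re (x \<bullet>c x)"
proof -
  note Ac = hermitian_matD(1)[OF A]
  have "(- m) * Re (x \<bullet>c x) \<le> Re (qform ((- 1) \<cdot>\<^sub>m A) x)"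
  proof (rule hermitian_qform_ge[OF _ _ x])
    show "hermitian_mat n ((- 1) \<cdot>\<^sub>m A)" by (rule hermitian_mat_smult[OF A]) simp
    fix t assume "complex_of_real t \<in> spectrum ((- 1) \<cdot>\<^sub>m A)"
    from spectrum_smult_matD[OF Ac _ this] ev[of "- t"] show "- m \<le> t" by simp
  qed
  then show ?thesis by (simp add: qform_simps[OF Ac x])
qed

lemma qform_hermitian_real:
  assumes A: "hermitian_mat n A" and x: "x \<in> carrier_vec n"
  shows "Im (qform A x) = 0"
proof -
  have "A *\<^sub>v x \<in> carrier_vec n" using hermitian_matD(1)[OF A] x by simp
  then have "x \<bullet>c (A *\<^sub>v x) = cnj (qform A x)"
    unfolding qform_def using x by (intro cscalar_prod_commute)
  then have "qform A x = cnj (qform A x)"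
    using hermitian_matD(2)[OF A x x] by (simp add: qform_def)
  then show ?thesis by (metis complex_cnj_zero_iff complex_cnj cnj.simps(2) equal_neg_zero)
qed

section \<open>Matrices with a spectral gap\<close>

text \<open>
  Spectral mapping for \<open>z\<^sup>2 - s z\<close>: with \<open>p\<close>, \<open>q\<close> the roots of \<open>z\<^sup>2 - s z - t\<close>, an
  eigenvector \<open>v\<close> for \<open>t\<close> satisfies \<open>(A - p) (A - q) v = 0\<close>. So either \<open>v\<close> is an eigenvector of \<open>A\<close>
  for \<open>q\<close>, or \<open>(A - q) v\<close> is one for \<open>p\<close>.
\<close>
lemma spectrum_square_minus_smultD:
  fixes A :: "complex mat"
  assumes A: "A \<in> carrier_mat n n" and t: "t \<in> spectrum (A * A + (- s) \<cdot>\<^sub>m A)"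
  obtains l where "l \<in> spectrum A" "t = l\<^sup>2 - s * l"
proof -
  obtain v where v: "v \<in> carrier_vec n" "v \<noteq> 0\<^sub>v n" "(A * A + (- s) \<cdot>\<^sub>m A) *\<^sub>v v = t \<cdot>\<^sub>v v"
    using t A by (auto simp: spectrum_def eigenvalue_def eigenvector_def)
  define d where "d = csqrt (s\<^sup>2 + 4 * t)"
  define p where "p = (s + d) / 2"
  define q where "q = (s - d) / 2"
  have d2: "d\<^sup>2 = s\<^sup>2 + 4 * t" by (simp add: d_def)
  have p: "t = p\<^sup>2 - s * p" and q: "t = q\<^sup>2 - s * q"
    using d2 by (simp_all add: p_def q_def power2_eq_square field_simps)
  have pq: "p + q = s" "p * q = - t"
    using d2 by (simp_all add: p_def q_def power2_eq_square field_simps)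
  define w where "w = A *\<^sub>v v + (- q) \<cdot>\<^sub>v v"
  have Av: "A *\<^sub>v v \<in> carrier_vec n" using A v by simp
  have AAv: "A *\<^sub>v (A *\<^sub>v v) \<in> carrier_vec n" using A Av by simp
  have w: "w \<in> carrier_vec n" using Av v by (simp add: w_def)
  show thesis
  proof (cases "w = 0\<^sub>v n")
    case True
    have "A *\<^sub>v v = q \<cdot>\<^sub>v v"
    proof (rule eq_vecI)
      fix i assume "i < dim_vec (q \<cdot>\<^sub>v v)"
      then have i: "i < n" using v by simp
      have "w $ i = 0" using True i by simp
      then show "(A *\<^sub>v v) $ i = (q \<cdot>\<^sub>v v) $ i" using i A v by (simp add: w_def)
    qed (use A v in auto)
    then have "q \<in> spectrum A"
      using A v by (auto simp: spectrum_def eigenvalue_def eigenvector_def)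
    then show thesis using q by (rule that)
  next
    case False
    have AA: "A *\<^sub>v (A *\<^sub>v v) + (- s) \<cdot>\<^sub>v (A *\<^sub>v v) = t \<cdot>\<^sub>v v"
      using v(3) A v(1)
      by (simp add: add_mult_distrib_mat_vec[of _ n n] smult_mat_mult_vec[of _ n n])
    have "A *\<^sub>v w = A *\<^sub>v (A *\<^sub>v v) + (- q) \<cdot>\<^sub>v (A *\<^sub>v v)"
      unfolding w_def using A Av v by (simp add: mult_add_distrib_mat_vec[of _ n n] mult_mat_vec[of _ n n])
    also have "\<dots> = p \<cdot>\<^sub>v w"
    proof (rule eq_vecI)
      fix i assume "i < dim_vec (p \<cdot>\<^sub>v w)"
      then have i: "i < n" using w by simp
      have "(A *\<^sub>v (A *\<^sub>v v)) $ i - s * (A *\<^sub>v v) $ i = t * v $ i"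
        using arg_cong[OF AA, of "\<lambda>u. u $ i"] i Av AAv v A by simp
      then have "(A *\<^sub>v (A *\<^sub>v v)) $ i = (p + q) * (A *\<^sub>v v) $ i - p * q * v $ i"
        using pq by (simp add: algebra_simps)
      then show "(A *\<^sub>v (A *\<^sub>v v) + (- q) \<cdot>\<^sub>v (A *\<^sub>v v)) $ i = (p \<cdot>\<^sub>v w) $ i"
        using i Av AAv v A by (simp add: w_def algebra_simps)
    qed (use A Av AAv w in auto)
    finally have "p \<in> spectrum A"
      using A w False by (auto simp: spectrum_def eigenvalue_def eigenvector_def)
    then show thesis using p by (rule that)
  qed
qed

lemma hermitian_mat_square:
  assumes A: "hermitian_mat n A"
  shows "hermitian_mat n (A * A)"
  using assms hermitian_matD(1)[OF A] unfolding hermitian_mat_def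
  by (auto simp: assoc_mult_mat_vec[of _ n n _ n])

text \<open>
  The two inequalities say that the forms of \<open>A\<^sup>2 - a A\<close> and of \<open>b A - A\<^sup>2\<close> are nonnegative, and
  \<open>l (l - a)\<close> and \<open>l (b - l)\<close> are nonnegative both at \<open>l = 0\<close> and for \<open>a \<le> l \<le> b\<close>.
\<close>
lemma norm_mult_spectral_gap:
  assumes A: "hermitian_mat n A"
    and spec: "spectrum A \<subseteq> complex_of_real ` ({0} \<union> {a..b})" and a: "a > 0"
    and x: "x \<in> carrier_vec n"
  shows "a * Re (qform A x) \<le> Re ((A *\<^sub>v x) \<bullet>c (A *\<^sub>v x))"
    and "Re ((A *\<^sub>v x) \<bullet>c (A *\<^sub>v x)) \<le> b * Re (qform A x)"
proof -
  note Ac = hermitian_matD(1)[OF A]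
  define P where "P s = A * A + (- complex_of_real s) \<cdot>\<^sub>m A" for s
  have h: "hermitian_mat n (P s)" for s
    unfolding P_def
    by (intro hermitian_mat_add hermitian_mat_square hermitian_mat_smult A) simp
  have "qform (A * A) x = (A *\<^sub>v x) \<bullet>c (A *\<^sub>v x)"
    using Ac x hermitian_matD(2)[OF A, of "A *\<^sub>v x" x]
    by (simp add: qform_def assoc_mult_mat_vec[of _ n n _ n])
  then have q: "Re (qform (P s) x) = Re ((A *\<^sub>v x) \<bullet>c (A *\<^sub>v x)) - s * Re (qform A x)" for s
    using Ac x by (simp add: P_def qform_simps[where n=n])
  have ev: "\<exists>l. t = l * (l - s) \<and> (l = 0 \<or> a \<le> l \<and> l \<le> b)"
    if t: "complex_of_real t \<in> spectrum (P s)" for s t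
  proof -
    obtain l where "l \<in> spectrum A" "complex_of_real t = l\<^sup>2 - complex_of_real s * l"
      using spectrum_square_minus_smultD[OF Ac t[unfolded P_def]] by metis
    moreover from this(1) spec obtain r where "l = complex_of_real r" "r \<in> {0} \<union> {a..b}"
      by blast
    ultimately have r: "complex_of_real t = (complex_of_real r)\<^sup>2 - complex_of_real s * complex_of_real r"
        "r = 0 \<or> a \<le> r \<and> r \<le> b"
      by auto
    then have "complex_of_real t = complex_of_real (r * (r - s))"
      by (simp add: power2_eq_square algebra_simps)
    then show ?thesis using r(2) of_real_eq_iff by blast
  qed
  have "0 * Re (x \<bullet>c x) \<le> Re (qform (P a) x)"
  proof (rule hermitian_qform_ge[OF h _ x])
    fix t assume "complex_of_real t \<in> spectrum (P a)"
    from ev[OF this] show "0 \<le> t" using a by (auto intro: mult_nonneg_nonneg)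
  qed
  then show "a * Re (qform A x) \<le> Re ((A *\<^sub>v x) \<bullet>c (A *\<^sub>v x))" by (simp add: q)
  have "Re (qform (P b) x) \<le> 0 * Re (x \<bullet>c x)"
  proof (rule hermitian_qform_le[OF h _ x])
    fix t assume "complex_of_real t \<in> spectrum (P b)"
    from ev[OF this] show "t \<le> 0" using a by (auto intro: mult_nonneg_nonpos)
  qed
  then show "Re ((A *\<^sub>v x) \<bullet>c (A *\<^sub>v x)) \<le> b * Re (qform A x)" by (simp add: q)
qed

section \<open>Real matrices and their symmetric and skew parts\<close>

lemma cmat_transpose_adjoint:
  assumes A: "A \<in> carrier_mat n n" and u: "u \<in> carrier_vec n" and v: "v \<in> carrier_vec n"
  shows "(cmat A *\<^sub>v u) \<bullet>c v = u \<bullet>c (cmat (transpose_mat A) *\<^sub>v v)"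
proof -
  have "(cmat A *\<^sub>v u) \<bullet>c v = (\<Sum>i<n. \<Sum>j<n. complex_of_real (A $$ (i,j)) * u $ j * cnj (v $ i))"
    using A u v by (auto simp: scalar_prod_def atLeast0LessThan sum_distrib_right)
  also have "\<dots> = (\<Sum>j<n. \<Sum>i<n. complex_of_real (A $$ (i,j)) * u $ j * cnj (v $ i))"
    by (rule sum.swap)
  also have "\<dots> = u \<bullet>c (cmat (transpose_mat A) *\<^sub>v v)"
    using A u v by (auto simp: scalar_prod_def atLeast0LessThan sum_distrib_left algebra_simps)
  finally show ?thesis .
qed

lemma hermitian_cmat:
  assumes "A \<in> carrier_mat n n" "transpose_mat A = A"
  shows "hermitian_mat n (cmat A)"
  using cmat_transpose_adjoint[of A n] assms by (auto simp: hermitian_mat_def)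

text \<open>
  Multiplying a real skew-symmetric matrix by \<open>\<i>\<close> makes it Hermitian, so the bounds for Hermitian
  forms also control its purely imaginary spectrum.
\<close>
lemma hermitian_ii_cmat:
  assumes A: "A \<in> carrier_mat n n" and skew: "transpose_mat A = - A"
  shows "hermitian_mat n (\<i> \<cdot>\<^sub>m cmat A)"
  unfolding hermitian_mat_def
proof (intro conjI ballI)
  show "\<i> \<cdot>\<^sub>m cmat A \<in> carrier_mat n n" using A by simp
  fix u v :: "complex vec" assume u: "u \<in> carrier_vec n" and v: "v \<in> carrier_vec n"
  have "cmat (- A) = (- 1) \<cdot>\<^sub>m cmat A" using A by auto
  then have "(cmat A *\<^sub>v u) \<bullet>c v = - (u \<bullet>c (cmat A *\<^sub>v v))"
    using cmat_transpose_adjoint[OF A u v] skew A u v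
    by (simp add: smult_mat_mult_vec[of _ n n] cscalar_prod_simps[where n=n])
  then show "((\<i> \<cdot>\<^sub>m cmat A) *\<^sub>v u) \<bullet>c v = u \<bullet>c ((\<i> \<cdot>\<^sub>m cmat A) *\<^sub>v v)"
    using A u v
    by (simp add: smult_mat_mult_vec[of _ n n] cscalar_prod_simps[where n=n])
qed

lemma cmat_add:
  assumes "A \<in> carrier_mat n m" "B \<in> carrier_mat n m"
  shows "cmat (A + B) = cmat A + cmat B"
  using assms by (intro eq_matI) auto

text \<open>
  The form of \<open>H\<close> is the sum of the form of the symmetric part, which is real, and the form of the
  skew part, which is \<open>- \<i>\<close> times a real number; the two bounds are therefore independent.
\<close>
lemma qform_cmat_rectangle:
  assumes H: "H \<in> carrier_mat n n" and y: "y \<in> carrier_vec n"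
    and S: "spectrum (cmat (sym_part H)) \<subseteq> complex_of_real ` {a..b}"
    and K: "spectrum (cmat (skew_part H)) \<subseteq> (\<lambda>t. \<i> * complex_of_real t) ` {-c..c}"
  shows "a * Re (y \<bullet>c y) \<le> Re (qform (cmat H) y)"
    and "Re (qform (cmat H) y) \<le> b * Re (y \<bullet>c y)"
    and "\<bar>Im (qform (cmat H) y)\<bar> \<le> c * Re (y \<bullet>c y)"
proof -
  have Sc: "sym_part H \<in> carrier_mat n n" and Kc: "skew_part H \<in> carrier_mat n n"
    using H by (auto simp: sym_part_def skew_part_def)
  have "H = sym_part H + skew_part H"
    using H by (auto simp: sym_part_def skew_part_def field_simps)
  then have "cmat H = cmat (sym_part H) + cmat (skew_part H)"
    using Sc Kc by (metis cmat_add)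
  then have split: "qform (cmat H) y = qform (cmat (sym_part H)) y + qform (cmat (skew_part H)) y"
    using Sc Kc y by (simp add: qform_simps[where n=n])
  have hS: "hermitian_mat n (cmat (sym_part H))"
    using H by (intro hermitian_cmat[OF Sc]) (auto simp: sym_part_def)
  have hK: "hermitian_mat n (\<i> \<cdot>\<^sub>m cmat (skew_part H))"
    using H by (intro hermitian_ii_cmat[OF Kc]) (auto simp: skew_part_def field_simps)
  have iK: "qform (\<i> \<cdot>\<^sub>m cmat (skew_part H)) y = \<i> * qform (cmat (skew_part H)) y"
    using Kc y by (simp add: qform_simps[where n=n])
  have Re: "Re (qform (cmat H) y) = Re (qform (cmat (sym_part H)) y)"
    and Im: "Im (qform (cmat H) y) = - Re (qform (\<i> \<cdot>\<^sub>m cmat (skew_part H)) y)"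
    using split qform_hermitian_real[OF hS y] qform_hermitian_real[OF hK y] by (simp_all add: iK)
  show "a * Re (y \<bullet>c y) \<le> Re (qform (cmat H) y)"
    unfolding Re by (rule hermitian_qform_ge[OF hS _ y]) (use S in force)
  show "Re (qform (cmat H) y) \<le> b * Re (y \<bullet>c y)"
    unfolding Re by (rule hermitian_qform_le[OF hS _ y]) (use S in force)
  have ev: "\<bar>t\<bar> \<le> c" if t: "complex_of_real t \<in> spectrum (\<i> \<cdot>\<^sub>m cmat (skew_part H))" for t
  proof -
    have "complex_of_real t / \<i> \<in> spectrum (cmat (skew_part H))"
      by (rule spectrum_smult_matD[OF _ _ t]) (use Kc in auto)
    then obtain r where "complex_of_real t / \<i> = \<i> * complex_of_real r" "r \<in> {-c..c}"
      using K by blast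
    then show ?thesis by (auto simp: complex_eq_iff)
  qed
  have "Re (qform (\<i> \<cdot>\<^sub>m cmat (skew_part H)) y) \<le> c * Re (y \<bullet>c y)"
    by (rule hermitian_qform_le[OF hK _ y]) (use ev in force)
  moreover have "(- c) * Re (y \<bullet>c y) \<le> Re (qform (\<i> \<cdot>\<^sub>m cmat (skew_part H)) y)"
    by (rule hermitian_qform_ge[OF hK _ y]) (use ev in force)
  ultimately show "\<bar>Im (qform (cmat H) y)\<bar> \<le> c * Re (y \<bullet>c y)"
    unfolding Im by simp
qed

section \<open>Covering the numerical range by a disk\<close>

text \<open>
  Since \<open>|z - c|\<^sup>2 = |z|\<^sup>2 - 2 c Re z + c\<^sup>2 \<le> M - 2 c a0 + c\<^sup>2\<close>, the radius with \<open>\<rho>\<^sup>2 = c\<^sup>2 - a0 c < c\<^sup>2\<close> is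
  large enough as soon as \<open>M \<le> a0 c\<close>. The summand \<open>2 * a0\<close> in \<open>c\<close> keeps \<open>c > a0\<close>, hence
  \<open>\<rho> > 0\<close>.
\<close>
lemma bounded_half_plane_in_cball:
  assumes a0: "a0 > 0" and M: "M \<ge> 0"
  obtains c \<rho> :: real where "c > \<rho>" "\<rho> > 0"
    "\<And>z. a0 \<le> Re z \<Longrightarrow> (Re z)\<^sup>2 + (Im z)\<^sup>2 \<le> M \<Longrightarrow> z \<in> cball (complex_of_real c) \<rho>"
proof -
  define c where "c = M / a0 + 2 * a0"
  define \<rho> where "\<rho> = sqrt (c * (c - a0))"
  have c: "c \<ge> 2 * a0" "M \<le> a0 * c" using a0 M by (auto simp: c_def field_simps)
  have "\<rho> > 0" using c a0 by (simp add: \<rho>_def)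
  moreover have "\<rho> < sqrt (c * c)"
    unfolding \<rho>_def using c a0 by (intro real_sqrt_less_mono) (auto simp: algebra_simps)
  then have "\<rho> < c" using c a0 by simp
  moreover have "z \<in> cball (complex_of_real c) \<rho>"
    if z: "a0 \<le> Re z" "(Re z)\<^sup>2 + (Im z)\<^sup>2 \<le> M" for z
  proof -
    have "a0 * c \<le> Re z * c" using z c a0 by (intro mult_right_mono) auto
    then have "(c - Re z)\<^sup>2 + (Im z)\<^sup>2 \<le> c * (c - a0)"
      using z(2) c(2) by (simp add: power2_eq_square algebra_simps)
    then show ?thesis by (simp add: dist_norm cmod_def \<rho>_def)
  qed
  ultimately show thesis using that by blast
qed

theorem proposition2p2:
  fixes \<xi>1 \<xi>2 \<xi>3 \<xi>4 \<xi>5 :: real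
  assumes "\<xi>1 > 0" and "\<xi>4 > 0"
  shows "\<exists>c1 \<rho>1 :: real. c1 > \<rho>1 \<and> \<rho>1 > 0 \<and>
    (\<forall>(N::nat) (C::real mat) (G::real mat) (H::real mat) (B::real mat).
       sym_pos_semidef_mat N C \<longrightarrow>
       pos_def_mat N G \<longrightarrow>
       H \<in> carrier_mat N N \<and> inverts_mat G H \<and> inverts_mat H G \<longrightarrow>
       B = H * C \<longrightarrow>
       pos_def_mat N (sym_part H) \<longrightarrow>
       spectrum (cmat (sym_part H)) \<subseteq> complex_of_real ` {\<xi>1..\<xi>2} \<longrightarrow>
       spectrum (cmat (skew_part H)) \<subseteq> (\<lambda>t. \<i> * complex_of_real t) ` {-\<xi>3..\<xi>3} \<longrightarrow>
       spectrum (cmat C) \<subseteq> complex_of_real ` ({0} \<union> {\<xi>4..\<xi>5}) \<longrightarrow>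
       C_numerical_range (cmat C) (cmat B) \<subseteq> cball (complex_of_real c1) \<rho>1)"
proof -
  define M where "M = (\<xi>2 * \<xi>5)\<^sup>2 + (\<xi>3 * \<xi>5)\<^sup>2"
  have "\<xi>1 * \<xi>4 > 0" "M \<ge> 0" using assms by (auto simp: M_def)
  then obtain c \<rho> :: real where c: "c > \<rho>" "\<rho> > 0"
    and disk: "\<And>z. \<xi>1 * \<xi>4 \<le> Re z \<Longrightarrow> (Re z)\<^sup>2 + (Im z)\<^sup>2 \<le> M \<Longrightarrow> z \<in> cball (complex_of_real c) \<rho>"
    using bounded_half_plane_in_cball by metis
  have "z \<in> cball (complex_of_real c) \<rho>"
    if C: "sym_pos_semidef_mat N C" and H: "H \<in> carrier_mat N N"
      and S: "spectrum (cmat (sym_part H)) \<subseteq> complex_of_real ` {\<xi>1..\<xi>2}"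
      and K: "spectrum (cmat (skew_part H)) \<subseteq> (\<lambda>t. \<i> * complex_of_real t) ` {-\<xi>3..\<xi>3}"
      and spec: "spectrum (cmat C) \<subseteq> complex_of_real ` ({0} \<union> {\<xi>4..\<xi>5})"
      and z: "z \<in> C_numerical_range (cmat C) (cmat (H * C))"
    for N C H z
  proof -
    have Cc: "C \<in> carrier_mat N N" and hC: "hermitian_mat N (cmat C)"
      using C hermitian_cmat by (auto simp: sym_pos_semidef_mat_def)
    obtain x where x: "x \<in> carrier_vec N" and q1: "Re (qform (cmat C) x) = 1"
      and zx: "z = qform (cmat C * cmat (H * C)) x"
      using z Cc by (auto simp: C_numerical_range_def C_norm_def)
    define y where "y = cmat C *\<^sub>v x"
    have y: "y \<in> carrier_vec N" using Cc x by (simp add: y_def)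
    have "(cmat C * cmat (H * C)) *\<^sub>v x = cmat C *\<^sub>v (cmat H *\<^sub>v y)"
      unfolding of_real_hom.mat_hom_mult[OF H Cc] y_def
      using Cc H x by (simp add: assoc_mult_mat_vec[of _ N N _ N])
    then have zy: "z = qform (cmat H) y"
      using hermitian_matD(2)[OF hC _ x, of "cmat H *\<^sub>v y"] H y
      by (simp add: zx qform_def y_def)
    define r where "r = Re (y \<bullet>c y)"
    have r: "\<xi>4 \<le> r" "r \<le> \<xi>5"
      using norm_mult_spectral_gap[OF hC spec \<open>\<xi>4 > 0\<close> x] by (auto simp: q1 r_def y_def)
    note rect = qform_cmat_rectangle[OF H y S K, folded r_def zy]
    have "\<xi>1 * \<xi>4 \<le> \<xi>1 * r" using r assms by (intro mult_left_mono) auto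
    with rect(1) have lo: "\<xi>1 * \<xi>4 \<le> Re z" by linarith
    \<comment> \<open>absolute values, because no sign is assumed for \<open>\<xi>2\<close> and \<open>\<xi>3\<close>\<close>
    have "\<bar>Re z\<bar> \<le> \<bar>\<xi>2 * \<xi>5\<bar>"
    proof -
      have "0 < Re z" using lo \<open>\<xi>1 * \<xi>4 > 0\<close> by linarith
      moreover have "\<xi>2 * r \<le> \<bar>\<xi>2\<bar> * r" using r assms by (intro mult_right_mono) auto
      ultimately have "\<bar>Re z\<bar> \<le> \<bar>\<xi>2\<bar> * r" using rect(2) by linarith
      also have "\<dots> \<le> \<bar>\<xi>2\<bar> * \<bar>\<xi>5\<bar>" using r by (intro mult_left_mono) auto
      finally show ?thesis by (simp add: abs_mult)
    qed
    moreover have "\<bar>Im z\<bar> \<le> \<bar>\<xi>3 * \<xi>5\<bar>"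
    proof -
      have "\<xi>3 * r \<le> \<bar>\<xi>3\<bar> * \<bar>\<xi>5\<bar>"
        using r assms by (intro mult_mono) auto
      with rect(3) show ?thesis by (simp add: abs_mult)
    qed
    ultimately have "(Re z)\<^sup>2 + (Im z)\<^sup>2 \<le> M"
      unfolding M_def by (intro add_mono) (simp_all only: abs_le_square_iff)
    with lo show ?thesis by (rule disk)
  qed
  then show ?thesis using c by (intro exI[of _ c] exI[of _ \<rho>]) blast
qed

end
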